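(* Every graph $G$ whose colouring number $\operatorname{col}(G)$ is infinite possesses a good well-ordering of its vertex set whose length (order type) is the cardinal $|V(G)|$.
   Context: Graphs are simple and undirected, possibly infinite; $N(v)$ denotes the set of neighbours of a vertex $v$. The colouring number $\operatorname{col}(G)$ of a graph $G=(V,E)$ is the smallest cardinal $\kappa$ such that there exists a well-ordering $<^*$ of $V$ with $|N(v)\cap\{w : w<^* v\}|<\kappa$ for all $v\in V$. Well-orderings of $V$ with this property for $\kappa=\operatorname{col}(G)$ are called good. A cardinal is identified with its initial ordinal, so a well-ordering of length $|V(G)|$ is one whose order type is this initial ordinal. *)

theory Defs
  imports Main
begin

unbundle cardinal_syntax

definition simple_graph :: "'a set \<Rightarrow> 'a set set \<Rightarrow> bool" where
  "simple_graph V E \<longleftrightarrow> (\<forall>e\<in>E. e \<subseteq> V \<and> card e = 2)"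

definition neighbours :: "'a set set \<Rightarrow> 'a \<Rightarrow> 'a set" where
  "neighbours E v = {w. {v, w} \<in> E}"

text \<open>
  Cardinals are represented, as in \<^theory>\<open>HOL.BNF_Cardinal_Order_Relation\<close>, by cardinal orders
  (minimal well-orders on their fields), compared by \<open><o\<close>, \<open>\<le>o\<close> and \<open>=o\<close>.
\<close>

definition back_degrees_less ::
    "'a set \<Rightarrow> 'a set set \<Rightarrow> 'a rel \<Rightarrow> 'b rel \<Rightarrow> bool" where
  "back_degrees_less V E R \<kappa> \<longleftrightarrow>
     well_order_on V R \<and> (\<forall>v\<in>V. |neighbours E v \<inter> underS R v| <o \<kappa>)"

text \<open>
  The smallest cardinal is unique only up to \<open>=o\<close>, hence the choice of a representative. HOL cannot
  quantify over cardinals on all types at once; restricting to cardinal orders on the vertex type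
  loses nothing, because \<open>|V|\<close> is always an admissible cardinal: see \<open>colouring_number_works\<close>
  and \<open>colouring_number_least\<close>.
\<close>

definition colouring_number :: "'a set \<Rightarrow> 'a set set \<Rightarrow> 'a rel" where
  "colouring_number V E = (SOME \<kappa>.
     Card_order \<kappa> \<and> (\<exists>R. back_degrees_less V E R \<kappa>) \<and>
     (\<forall>\<mu> :: 'a rel. Card_order \<mu> \<and> (\<exists>R. back_degrees_less V E R \<mu>) \<longrightarrow> \<kappa> \<le>o \<mu>))"

definition good_well_order :: "'a set \<Rightarrow> 'a set set \<Rightarrow> 'a rel \<Rightarrow> bool" where
  "good_well_order V E R \<longleftrightarrow> back_degrees_less V E R (colouring_number V E)"

lemma back_degrees_less_card_of: "back_degrees_less V E |V| |V|"
  unfolding back_degrees_less_def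
proof (intro conjI ballI)
  show "well_order_on V |V|" by (rule card_of_well_order_on)
next
  fix v assume "v \<in> V"
  then have "|underS (card_of V) v| <o |V|"
    by (intro card_of_underS card_of_Card_order) (simp add: Field_card_of)
  moreover have "|neighbours E v \<inter> underS (card_of V) v| \<le>o |underS (card_of V) v|"
    by (rule card_of_mono1) simp
  ultimately show "|neighbours E v \<inter> underS (card_of V) v| <o |V|"
    using ordLeq_ordLess_trans by blast
qed

lemma colouring_number_props:
  "Card_order (colouring_number V E) \<and> (\<exists>R. back_degrees_less V E R (colouring_number V E)) \<and>
   (\<forall>\<mu> :: 'a rel. Card_order \<mu> \<and> (\<exists>R. back_degrees_less V E R \<mu>)
      \<longrightarrow> colouring_number V E \<le>o \<mu>)"
  for V :: "'a set"
proof -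
  let ?S = "{\<mu> :: 'a rel. Card_order \<mu> \<and> (\<exists>R. back_degrees_less V E R \<mu>)}"
  have "|V| \<in> ?S" using back_degrees_less_card_of[of V E] card_of_Card_order[of V] by auto
  then have "\<exists>\<kappa>\<in>?S. \<forall>\<mu>\<in>?S. \<kappa> \<le>o \<mu>"
    by (intro exists_minim_Card_order) auto
  then have "\<exists>\<kappa> :: 'a rel. Card_order \<kappa> \<and> (\<exists>R. back_degrees_less V E R \<kappa>) \<and>
     (\<forall>\<mu> :: 'a rel. Card_order \<mu> \<and> (\<exists>R. back_degrees_less V E R \<mu>) \<longrightarrow> \<kappa> \<le>o \<mu>)"
    unfolding Bex_def Ball_def mem_Collect_eq by blast
  then show ?thesis
    unfolding colouring_number_def by (rule someI_ex)
qed

lemma Card_order_colouring_number: "Card_order (colouring_number V E)"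
  using colouring_number_props[of V E] by simp

lemma colouring_number_works: "\<exists>R. good_well_order V E R"
  using colouring_number_props[of V E] unfolding good_well_order_def by simp

lemma colouring_number_least:
  fixes V :: "'a set" and \<mu> :: "'b rel"
  assumes \<mu>: "Card_order \<mu>" and R: "back_degrees_less V E R \<mu>"
  shows "colouring_number V E \<le>o \<mu>"
proof (cases "\<mu> \<le>o |V|")
  case True
  then obtain p :: "'a rel" where p: "\<mu> =o p"
    using internalize_ordLeq[of \<mu> "|V|"] by blast
  then have "Card_order p" using Card_order_ordIso2[OF \<mu> p] by simp
  moreover have "back_degrees_less V E R p"
    using R unfolding back_degrees_less_def by (auto intro: ordLess_ordIso_trans[OF _ p])
  ultimately have "colouring_number V E \<le>o p"
    using colouring_number_props[of V E] by auto
  then show ?thesis by (rule ordLeq_ordIso_trans[OF _ ordIso_symmetric[OF p]])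
next
  case False
  then have "|V| \<le>o \<mu>"
    using ordLeq_total[OF card_of_Well_order card_order_on_well_order_on[OF \<mu>]] by blast
  moreover have "colouring_number V E \<le>o |V|"
    using colouring_number_props[of V E] back_degrees_less_card_of[of V E] card_of_Card_order[of V] by auto
  ultimately show ?thesis by (rule ordLeq_transitive[rotated])
qed

end

theory Submission
  imports Defs
begin

text \<open>
  Let \<open>R\<close> be a good well-ordering with \<open>\<kappa> < |V|\<close>. The set \<open>cl x\<close> of vertices reachable from
  \<open>x\<close> by paths descending in \<open>R\<close> has size at most \<open>\<kappa>\<close>. Assign each vertex to the first \<open>x\<close>, in an
  ordering of \<open>V\<close> of length \<open>|V|\<close>, with the vertex in \<open>cl x\<close>; order the resulting blocks by \<open>x\<close>, and
  each block in order type its cardinality. As unions of sets \<open>cl x\<close> are closed under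
  \<open>R\<close>-smaller neighbours, the neighbours of \<open>v\<close> in earlier blocks are \<open>R\<close>-smaller than \<open>v\<close>, so there
  are fewer than \<open>\<kappa>\<close> of them; and fewer than \<open>\<kappa>\<close> vertices precede \<open>v\<close> in its own block. Every
  proper initial segment is covered by fewer than \<open>|V|\<close> blocks of size at most \<open>\<kappa>\<close>, so the length is
  \<open>|V|\<close>.
\<close>

text \<open>The ordered sum along \<open>r\<close> of the blocks of \<open>a\<close>, the block of
  \<open>i\<close> being ordered by \<open>s i\<close>. The guard \<open>a v \<noteq> a w\<close>
  keeps the reflexive pairs of \<open>r\<close> from relating all vertices of one block.\<close>

definition block_order :: "'a set \<Rightarrow> ('a \<Rightarrow> 'i) \<Rightarrow> 'i rel \<Rightarrow> ('i \<Rightarrow> 'a rel) \<Rightarrow> 'a rel" where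
  "block_order V a r s =
    {(v, w). v \<in> V \<and> w \<in> V \<and> (a v \<noteq> a w \<and> (a v, a w) \<in> r \<or> a v = a w \<and> (v, w) \<in> s (a v))}"

lemma well_order_on_block_order:
  fixes V :: "'a set"
  assumes r: "well_order_on I r" and a: "a ` V \<subseteq> I"
    and s: "\<And>i. i \<in> I \<Longrightarrow> well_order_on {v \<in> V. a v = i} (s i)"
  shows "well_order_on V (block_order V a r s)"
proof -
  have r': "refl_on I r" "trans r" "antisym r" "total_on I r" "wf (r - Id)"
    using r by (auto simp: order_on_defs well_order_on_def)
  have s': "refl_on {v \<in> V. a v = a w} (s (a w))" "trans (s (a w))" "antisym (s (a w))"
      "total_on {v \<in> V. a v = a w} (s (a w))" "wf (s (a w) - Id)" if "w \<in> V" for w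
    using s[of "a w"] a that by (auto simp: order_on_defs well_order_on_def)
  have "refl_on V (block_order V a r s)"
    using s'(1) by (auto simp: refl_on_def block_order_def)
  moreover have "block_order V a r s \<subseteq> V \<times> V"
    by (auto simp: block_order_def)
  moreover have "trans (block_order V a r s)"
  proof (rule transI)
    fix x y z
    assume xy: "(x, y) \<in> block_order V a r s" and yz: "(y, z) \<in> block_order V a r s"
    have "x \<in> V" "y \<in> V" "z \<in> V" using xy yz by (auto simp: block_order_def)
    with xy yz show "(x, z) \<in> block_order V a r s"
      using transD[OF r'(2), of "a x" "a y" "a z"] antisymD[OF r'(3), of "a x" "a y"]
        transD[OF s'(2), of x x y z]
      by (auto simp: block_order_def)
  qed
  moreover have "antisym (block_order V a r s)"
    using antisymD[OF r'(3)] antisymD[OF s'(3)] by (fastforce simp: antisym_def block_order_def)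
  moreover have "total_on V (block_order V a r s)"
  proof (rule total_onI)
    fix x y assume "x \<in> V" "y \<in> V" "x \<noteq> y"
    moreover from this a have "a x \<in> I" "a y \<in> I" by auto
    ultimately show "(x, y) \<in> block_order V a r s \<or> (y, x) \<in> block_order V a r s"
      using r'(4)[unfolded total_on_def, rule_format, of "a x" "a y"]
        s'(4)[of x, unfolded total_on_def, rule_format, of x y]
      by (cases "a x = a y") (simp_all add: block_order_def)
  qed
  moreover have "wf (block_order V a r s - Id)"
  proof (rule wfI_min)
    fix x and Q :: "'a set" assume x: "x \<in> Q"
    show "\<exists>z\<in>Q. \<forall>y. (y, z) \<in> block_order V a r s - Id \<longrightarrow> y \<notin> Q"
    \<comment> \<open>Points outside \<open>V\<close> have no predecessors. Otherwise take the
      \<open>r\<close>-least block that meets \<open>Q\<close>, then the least element of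
      \<open>Q\<close> in that block.\<close>
    proof (cases "Q \<inter> V = {}")
      case True
      with x show ?thesis by (auto simp: block_order_def)
    next
      case False
      then obtain v0 where "v0 \<in> Q \<inter> V" by auto
      then have "a v0 \<in> a ` (Q \<inter> V)" by simp
      from wfE_min[OF r'(5) this] obtain w where w: "w \<in> Q \<inter> V"
        and min_w: "\<And>v. (a v, a w) \<in> r - Id \<Longrightarrow> v \<notin> Q \<inter> V" by (metis (no_types) image_iff)
      have "w \<in> {v \<in> Q \<inter> V. a v = a w}" using w by simp
      from wfE_min[OF s'(5) this] w obtain z where z: "z \<in> Q \<inter> V" "a z = a w"
        and min_z: "\<And>v. (v, z) \<in> s (a w) - Id \<Longrightarrow> v \<notin> {v \<in> Q \<inter> V. a v = a w}" by blast
      have "y \<notin> Q" if "(y, z) \<in> block_order V a r s - Id" for y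
        using that z min_w[of y] min_z[of y]
        by (cases "a y = a w") (simp_all add: block_order_def)
      with z show ?thesis by blast
    qed
  qed
  ultimately show ?thesis
    by (auto simp: order_on_defs well_order_on_def)
qed

text \<open>A well-ordering longer than \<open>|V|\<close> has a proper initial segment isomorphic
  to \<open>|V|\<close>, and that segment would have size at least \<open>|V|\<close>.\<close>

lemma ordIso_card_of_if_card_of_underS_less:
  assumes R: "well_order_on V R" and less: "\<And>v. v \<in> V \<Longrightarrow> |underS R v| <o |V|"
  shows "R =o |V|"
proof (rule ccontr)
  assume "\<not> R =o |V|"
  have F: "Field R = V" and W: "Well_order R"
    using R well_order_on_Field by auto
  have "|V| \<le>o R" using R by (rule card_of_least)
  with \<open>\<not> R =o |V|\<close> have "|V| <o R"
    using ordLeq_iff_ordLess_or_ordIso ordIso_symmetric by blast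
  then obtain v where v: "v \<in> V" and iso: "|V| =o Restr R (underS R v)"
    using ordLess_iff_ordIso_Restr[OF W card_of_Well_order, of V] F by auto
  have "Field (Restr R (underS R v)) \<subseteq> underS R v" by (auto simp: Field_def)
  then have "|Field (Restr R (underS R v))| \<le>o |underS R v|"
    by (rule card_of_mono1)
  with card_of_cong[OF iso] have "|V| \<le>o |underS R v|"
    unfolding Field_card_of by (rule ordIso_ordLeq_trans)
  with less[OF v] show False using not_ordLess_ordLeq by blast
qed

text \<open>Sort the starting points by path length: by induction each length contributes at most
  \<open>\<kappa>\<close> of them, and there are only countably many lengths.\<close>

lemma card_of_rtrancl_le:
  assumes \<kappa>: "cinfinite \<kappa>" "Card_order \<kappa>"
    and B: "\<And>v. |{w. (w, v) \<in> B}| \<le>o \<kappa>"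
  shows "|{w. (w, x) \<in> B\<^sup>*}| \<le>o \<kappa>"
proof -
  have inf: "infinite (Field \<kappa>)" using \<kappa>(1) by (simp add: cinfinite_def)
  have level: "|{w. (w, x) \<in> B ^^ n}| \<le>o \<kappa>" for n
  proof (induction n)
    case 0
    have "|{w. (w, x) \<in> B ^^ 0}| <o \<kappa>"
      using \<kappa> card_of_Card_order
      by (intro Cfinite_ordLess_Cinfinite) (auto simp: cfinite_def Field_card_of)
    then show ?case by (rule ordLess_imp_ordLeq)
  next
    case (Suc n)
    \<comment> \<open>The step split off is the one at \<open>w\<close>, far from \<open>x\<close>,
      so the induction hypothesis bounds the index set of the union.\<close>
    have "{w. (w, x) \<in> B ^^ Suc n} = (\<Union>v\<in>{v. (v, x) \<in> B ^^ n}. {w. (w, v) \<in> B})"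
      using relpow_Suc_D2 relpow_Suc_I2 by fastforce
    then show ?case
      using UNION_Cinfinite_bound[OF Suc.IH, of "\<lambda>v. {w. (w, v) \<in> B}"] B \<kappa> by simp
  qed
  have "|UNIV :: nat set| \<le>o |Field \<kappa>|"
    using inf infinite_iff_card_of_nat by blast
  then have nat: "|UNIV :: nat set| \<le>o \<kappa>"
    using card_of_Field_ordIso[OF \<kappa>(2)] ordLeq_ordIso_trans by blast
  have "{w. (w, x) \<in> B\<^sup>*} = (\<Union>n. {w. (w, x) \<in> B ^^ n})"
    by (auto simp: rtrancl_is_UN_relpow)
  then show ?thesis
    using UNION_Cinfinite_bound[OF nat, of "\<lambda>n. {w. (w, x) \<in> B ^^ n}"] level \<kappa> by simp
qed

text \<open>The union has size at most the larger of \<open>|I|\<close> and \<open>\<kappa>\<close>,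
  both below \<open>|V|\<close>. The common bound \<open>\<kappa>\<close> on the pieces makes this
  work for singular \<open>|V|\<close> too.\<close>

lemma card_of_UNION_ordLess_bounded:
  assumes I: "|I| <o |V|" and \<kappa>: "cinfinite \<kappa>" "Card_order \<kappa>" "\<kappa> <o |V|"
    and A: "\<And>i. i \<in> I \<Longrightarrow> |A i| \<le>o \<kappa>"
  shows "|\<Union>i\<in>I. A i| <o |V|"
proof (cases "|I| \<le>o \<kappa>")
  case True
  then have "|\<Union>i\<in>I. A i| \<le>o \<kappa>"
    using A \<kappa> by (intro UNION_Cinfinite_bound) auto
  then show ?thesis using \<kappa>(3) by (rule ordLeq_ordLess_trans)
next
  case False
  then have le: "\<kappa> \<le>o |I|"
    using ordLeq_total[OF card_of_Well_order card_order_on_well_order_on[OF \<kappa>(2)]] by blast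
  then have "cinfinite |I|"
    using cinfinite_mono \<kappa>(1) by blast
  moreover have "\<forall>i\<in>I. |A i| \<le>o |I|"
    using A le ordLeq_transitive by blast
  ultimately have "|\<Union>i\<in>I. A i| \<le>o |I|"
    by (intro UNION_Cinfinite_bound card_of_mono1) (simp_all add: card_of_Card_order)
  then show ?thesis using I by (rule ordLeq_ordLess_trans)
qed

text \<open>Shortens a well-ordering while keeping the same bound \<open>\<kappa>\<close> on back
  degrees; with the colouring number as \<open>\<kappa>\<close>, goodness is preserved.\<close>

lemma back_degrees_less_short:
  fixes V :: "'a set" and \<kappa> :: "'b rel"
  assumes inf\<kappa>: "cinfinite \<kappa>" and co\<kappa>: "Card_order \<kappa>" and R: "back_degrees_less V E R \<kappa>"
  shows "\<exists>S. back_degrees_less V E S \<kappa> \<and> S =o |V|"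
proof (cases "\<kappa> <o |V|")
  case False
  \<comment> \<open>Here any ordering of length \<open>|V|\<close> will do: its proper initial
    segments are already smaller than \<open>\<kappa>\<close>.\<close>
  then have "|V| \<le>o \<kappa>"
    using ordLess_or_ordLeq[OF card_order_on_well_order_on[OF co\<kappa>] card_of_Well_order] by blast
  then have "back_degrees_less V E (card_of V) \<kappa>"
    using back_degrees_less_card_of[of V E] ordLess_ordLeq_trans
    unfolding back_degrees_less_def by blast
  then show ?thesis using card_of_refl by blast
next
  case True
  have infF: "infinite (Field \<kappa>)" using inf\<kappa> by (simp add: cinfinite_def)
  have infV: "infinite V"
    using card_of_mono2[OF ordLess_imp_ordLeq[OF True]] infF card_of_ordLeq_infinite
    unfolding Field_card_of by blast
  have WR: "well_order_on V R" and bdeg: "\<And>v. v \<in> V \<Longrightarrow> |neighbours E v \<inter> underS R v| <o \<kappa>"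
    using R by (auto simp: back_degrees_less_def)
  have totR: "total_on V R"
    using WR by (auto simp: order_on_defs well_order_on_def)

  define B where "B = {(w, v). v \<in> V \<and> w \<in> neighbours E v \<inter> underS R v}"
  define cl where "cl x = {w. (w, x) \<in> B\<^sup>*}" for x
  have cl_le: "|cl x| \<le>o \<kappa>" for x
    unfolding cl_def
  proof (rule card_of_rtrancl_le[OF inf\<kappa> co\<kappa>])
    fix v
    show "|{w. (w, v) \<in> B}| \<le>o \<kappa>"
    proof (cases "v \<in> V")
      case True
      then have "{w. (w, v) \<in> B} = neighbours E v \<inter> underS R v" by (auto simp: B_def)
      then show ?thesis using bdeg[OF True] ordLess_imp_ordLeq by simp
    next
      case False
      then have "{w. (w, v) \<in> B} = {}" by (auto simp: B_def)
      then show ?thesis using Card_order_empty[OF co\<kappa>] by simp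
    qed
  qed

  define r where "r = |V|"
  have Wr: "well_order_on V r" and Fr: "Field r = V" and cr: "Card_order r"
    unfolding r_def by (rule card_of_well_order_on, rule Field_card_of, rule card_of_Card_order)
  have antir: "antisym r" and totr: "total_on V r" and reflr: "refl_on V r" and wfr: "wf (r - Id)"
    using Wr by (auto simp: order_on_defs well_order_on_def)
  have "\<exists>x\<in>V. v \<in> cl x \<and> (\<forall>y\<in>V. v \<in> cl y \<longrightarrow> (x, y) \<in> r)" if v: "v \<in> V" for v
  proof -
    \<comment> \<open>The empty path makes \<open>v\<close> itself a candidate, so a least one
      exists.\<close>
    have "v \<in> {x \<in> V. v \<in> cl x}" using v by (simp add: cl_def)
    from wfE_min[OF wfr this] obtain x where x: "x \<in> V" "v \<in> cl x"
      and min: "\<And>y. (y, x) \<in> r - Id \<Longrightarrow> y \<notin> {x \<in> V. v \<in> cl x}" by blast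
    have "(x, y) \<in> r" if "y \<in> V" "v \<in> cl y" for y
      using min[of y] that x totr reflr by (cases "x = y") (auto simp: total_on_def refl_on_def)
    with x show ?thesis by blast
  qed
  then obtain a where aV: "\<And>v. v \<in> V \<Longrightarrow> a v \<in> V" and a_cl: "\<And>v. v \<in> V \<Longrightarrow> v \<in> cl (a v)"
    and a_min: "\<And>v y. v \<in> V \<Longrightarrow> y \<in> V \<Longrightarrow> v \<in> cl y \<Longrightarrow> (a v, y) \<in> r"
    by metis

  define blk where "blk i = {v \<in> V. a v = i}" for i
  define S where "S = block_order V a r (\<lambda>i. card_of (blk i))"
  have WS: "well_order_on V S"
    unfolding S_def
    by (rule well_order_on_block_order[OF Wr])
      (use aV card_of_well_order_on in \<open>auto simp: blk_def[symmetric]\<close>)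
  have blk_le: "|blk i| \<le>o \<kappa>" for i
  proof -
    have "blk i \<subseteq> cl i" using a_cl by (auto simp: blk_def)
    then show ?thesis using cl_le card_of_mono1 ordLeq_transitive by blast
  qed

  have deg: "|neighbours E v \<inter> underS S v| <o \<kappa>" if v: "v \<in> V" for v
  proof -
    have "v \<in> Field |blk (a v)|" using v by (simp add: blk_def Field_card_of)
    then have "|underS (card_of (blk (a v))) v| <o \<kappa>"
      by (intro ordLess_ordLeq_trans[OF card_of_underS blk_le] card_of_Card_order)
    then have "|(neighbours E v \<inter> underS R v) \<union> underS (card_of (blk (a v))) v| <o \<kappa>"
      by (rule card_of_Un_ordLess_infinite_Field[OF infF co\<kappa> bdeg[OF v]])
    moreover have "neighbours E v \<inter> underS S v
        \<subseteq> (neighbours E v \<inter> underS R v) \<union> underS (card_of (blk (a v))) v"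
    proof
      fix w assume w: "w \<in> neighbours E v \<inter> underS S v"
      then have wV: "w \<in> V" and "w \<noteq> v" by (auto simp: underS_def S_def block_order_def)
      show "w \<in> (neighbours E v \<inter> underS R v) \<union> underS (card_of (blk (a v))) v"
      proof (cases "a w = a v")
        case True
        with w show ?thesis by (auto simp: underS_def S_def block_order_def)
      next
        case False
        with w have lt: "(a w, a v) \<in> r" by (auto simp: underS_def S_def block_order_def)
        \<comment> \<open>If \<open>v\<close> came before its neighbour \<open>w\<close> in
          \<open>R\<close>, the edge would prolong the descent from \<open>a w\<close> to
          \<open>w\<close> down to \<open>v\<close>. Minimality would then put \<open>a v\<close> no
          later than \<open>a w\<close>, against \<open>lt\<close>.\<close>
        have "(v, w) \<notin> R"
        proof
          assume "(v, w) \<in> R"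
          then have "(v, w) \<in> B"
            using w wV \<open>w \<noteq> v\<close> by (auto simp: B_def underS_def neighbours_def insert_commute)
          then have "v \<in> cl (a w)"
            using a_cl[OF wV] by (auto simp: cl_def intro: converse_rtrancl_into_rtrancl)
          then have "(a v, a w) \<in> r" using a_min v aV[OF wV] by blast
          with lt False antir show False by (auto dest: antisymD)
        qed
        then have "(w, v) \<in> R" using totR v wV \<open>w \<noteq> v\<close> by (auto simp: total_on_def)
        then show ?thesis using w \<open>w \<noteq> v\<close> by (auto simp: underS_def)
      qed
    qed
    ultimately show ?thesis using card_of_mono1 ordLeq_ordLess_trans by blast
  qed

  have "|underS S v| <o |V|" if v: "v \<in> V" for v
  proof -
    have "|underS r (a v)| <o |V|"
      using card_of_underS[OF cr] Fr aV[OF v] by (simp add: r_def)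
    \<comment> \<open>The index \<open>a v\<close> is added since predecessors of \<open>v\<close>
      may also lie in its own block.\<close>
    moreover have "|{a v}| <o |V|"
      using infV card_of_Card_order
      by (intro Cfinite_ordLess_Cinfinite) (auto simp: cfinite_def cinfinite_def Field_card_of)
    ultimately have "|underS r (a v) \<union> {a v}| <o |V|"
      by (rule card_of_Un_ordLess_infinite[OF infV])
    then have "|\<Union>i \<in> underS r (a v) \<union> {a v}. blk i| <o |V|"
      using blk_le by (rule card_of_UNION_ordLess_bounded[OF _ inf\<kappa> co\<kappa> True])
    moreover have "underS S v \<subseteq> (\<Union>i \<in> underS r (a v) \<union> {a v}. blk i)"
      by (auto simp: underS_def S_def block_order_def blk_def)
    ultimately show ?thesis using card_of_mono1 ordLeq_ordLess_trans by blast
  qed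
  then have "S =o |V|" by (rule ordIso_card_of_if_card_of_underS_less[OF WS])
  then show ?thesis using WS deg by (auto simp: back_degrees_less_def)
qed

theorem theorem1p3:
  fixes V :: "'a set" and E :: "'a set set"
  assumes "simple_graph V E"
    and "cinfinite (colouring_number V E)"
  shows "\<exists>R. good_well_order V E R \<and> R =o |V|"
  using back_degrees_less_short[OF assms(2) Card_order_colouring_number]
    colouring_number_works[of V E]
  unfolding good_well_order_def by blast

end
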